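(* Let $\Omega\subseteq\mathbb{R}^d$ be a compact convex set with non-empty interior $\Omega^\circ$. Let $\mu_0,\mu_1$ have Lebesgue densities $p_0,p_1$ supported on $\Omega$ which are continuous, uniformly bounded, and bounded away from zero on $\Omega$. Define, for $\eta\in[0,\mathrm{diam}(\Omega)]$, $$\omega(\eta)=\sup_{z,z'\in\Omega,\ \|z-z'\|\le\eta}\max\Big\{\Big|\frac{p_0(z)}{p_0(z')}-1\Big|,\Big|\frac{p_1(z)}{p_1(z')}-1\Big|\Big\},$$ and assume that $\eta\mapsto\omega(\eta)+\eta$ is non-decreasing and that $\Psi(u)=\int\frac{du}{u+\omega(u)}$ (an indefinite integral) satisfies $\Psi(\varepsilon)\to-\infty$ as $\varepsilon\to0$. For $t\in(0,1)$ and $z\in\Omega^\circ$ let $$v(t,z)=\frac{\int_{S_t(z)}\delta\,p_0(z-t\delta)p_1(z+(1-t)\delta)\,d\delta}{\int_{S_t(z)}p_0(z-t\delta)p_1(z+(1-t)\delta)\,d\delta},\qquad S_t(z)=\{\delta\in\mathbb{R}^d: z-t\delta\in\Omega,\ z+(1-t)\delta\in\Omega\}.$$ Then for every $x\in\Omega^\circ$ there exists a unique Carathéodory solution of the rectified flow equation started at $x$, i.e. a unique function $z:[0,1]\to\Omega$ with $z(s)\in\Omega^\circ$ for $s\in[0,1)$ such that $$z(t)=x+\int_0^tv(s,z(s))\,ds\quad\text{for all }t\in[0,1].$$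
   Context: $v(t,z)$ equals $\mathbb{E}[X_1-X_0\mid (1-t)X_0+tX_1=z]$ for independent $X_0\sim\mu_0$, $X_1\sim\mu_1$; it is not defined on $\partial\Omega$, which is why solutions are required to stay in $\Omega^\circ$ before time $1$. *)

theory Defs
  imports "HOL-Analysis.Analysis"
begin

definition rf_omega :: "('a::euclidean_space \<Rightarrow> real) \<Rightarrow> ('a \<Rightarrow> real) \<Rightarrow> 'a set \<Rightarrow> real \<Rightarrow> real" where
  "rf_omega p0 p1 \<Omega> \<eta> =
     (SUP zz \<in> {(z, z'). z \<in> \<Omega> \<and> z' \<in> \<Omega> \<and> norm (z - z') \<le> \<eta>}.
        max \<bar>p0 (fst zz) / p0 (snd zz) - 1\<bar> \<bar>p1 (fst zz) / p1 (snd zz) - 1\<bar>)"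

definition rf_S :: "'a::euclidean_space set \<Rightarrow> real \<Rightarrow> 'a \<Rightarrow> 'a set" where
  "rf_S \<Omega> t z = {\<delta>. z - t *\<^sub>R \<delta> \<in> \<Omega> \<and> z + (1 - t) *\<^sub>R \<delta> \<in> \<Omega>}"

definition rf_v :: "('a::euclidean_space \<Rightarrow> real) \<Rightarrow> ('a \<Rightarrow> real) \<Rightarrow> 'a set \<Rightarrow> real \<Rightarrow> 'a \<Rightarrow> 'a" where
  "rf_v p0 p1 \<Omega> t z =
     (1 / integral (rf_S \<Omega> t z) (\<lambda>\<delta>. p0 (z - t *\<^sub>R \<delta>) * p1 (z + (1 - t) *\<^sub>R \<delta>)))
     *\<^sub>R integral (rf_S \<Omega> t z) (\<lambda>\<delta>. (p0 (z - t *\<^sub>R \<delta>) * p1 (z + (1 - t) *\<^sub>R \<delta>)) *\<^sub>R \<delta>)"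

end

theory Submission
  imports Defs "HOL-Complex_Analysis.Great_Picard"
begin

text \<open>Two facts about \<^term>\<open>rf_S \<Omega> t z\<close> carry the proof.

  If \<open>cball z' r \<subseteq> \<Omega>\<close> and \<open>(t, z)\<close>, \<open>(t', z')\<close> are \<open>\<eta>\<close>-close, convexity gives
  \<open>(r / (r + \<eta>)) rf_S \<Omega> t z \<subseteq> rf_S \<Omega> t' z'\<close>, so the two sets differ by measure \<open>O(\<eta>)\<close>.
  Hence \<open>v\<close> has modulus of continuity \<open>K\<^sub>r (\<eta> + \<omega>(\<eta>))\<close>, jointly in time and space, on
  the points at distance at least \<open>r\<close> from the boundary, and Osgood's criterion yields uniqueness.

  Moreover \<open>v(t,z)\<close>, a mean of the closed convex set \<open>rf_S \<Omega> t z\<close>, belongs to it, so the flow at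
  \<open>z\<close> always points to \<open>z + (1 - t) v(t,z) \<in> \<Omega>\<close>. If \<open>cball x r \<subseteq> \<Omega>\<close>, the Euler polygons from \<open>x\<close>
  therefore stay at distance at least \<open>r (1 - t)\<close> from the boundary, and a uniform limit of
  them is a solution.\<close>

section \<open>Integrability and convexity\<close>

text \<open>The ball on the left is the Minkowski combination of \<open>cball z r\<close> with
  weight 1 - \<mu> and the point y with weight \<mu>. With y the target point of the flow, this
  controls one Euler step.\<close>

lemma cball_convex_combination_subset:
  fixes z y :: "'a::real_normed_vector"
  assumes "convex \<Omega>" "cball z r \<subseteq> \<Omega>" "y \<in> \<Omega>" "0 \<le> \<mu>" "\<mu> \<le> 1" "0 \<le> r"
  shows "cball ((1 - \<mu>) *\<^sub>R z + \<mu> *\<^sub>R y) ((1 - \<mu>) * r) \<subseteq> \<Omega>"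
proof (cases "\<mu> = 1")
  case True
  then show ?thesis using assms by simp
next
  case False
  show ?thesis
  proof
    fix w assume w: "w \<in> cball ((1 - \<mu>) *\<^sub>R z + \<mu> *\<^sub>R y) ((1 - \<mu>) * r)"
    define e where "e = w - ((1 - \<mu>) *\<^sub>R z + \<mu> *\<^sub>R y)"
    have e: "norm e \<le> (1 - \<mu>) * r"
      using w by (simp add: e_def dist_norm norm_minus_commute)
    \<comment> \<open>Blowing the offset e up by 1 / (1 - \<mu>) undoes the shrinking of the ball
      about z.\<close>
    have "z + (1 / (1 - \<mu>)) *\<^sub>R e \<in> cball z r"
      using e False \<open>\<mu> \<le> 1\<close> by (simp add: dist_norm field_simps)
    with assms have "z + (1 / (1 - \<mu>)) *\<^sub>R e \<in> \<Omega>" by blast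
    then have "(1 - \<mu>) *\<^sub>R (z + (1 / (1 - \<mu>)) *\<^sub>R e) + \<mu> *\<^sub>R y \<in> \<Omega>"
      using assms by (intro convexD) auto
    moreover have "(1 - \<mu>) *\<^sub>R (z + (1 / (1 - \<mu>)) *\<^sub>R e) + \<mu> *\<^sub>R y = w"
      using False by (simp add: e_def scaleR_add_right)
    ultimately show "w \<in> \<Omega>" by simp
  qed
qed

lemma integrable_on_compact:
  fixes f :: "'a::euclidean_space \<Rightarrow> 'b::euclidean_space"
  assumes "compact T" "continuous_on T f"
  shows "f integrable_on T"
proof -
  have T: "T \<in> lmeasurable"
    using assms(1) by (rule lmeasurable_compact)
  have "bounded (f ` T)"
    using assms compact_continuous_image compact_imp_bounded by blast
  then obtain B where B: "\<And>x. x \<in> T \<Longrightarrow> norm (f x) \<le> B"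
    by (auto simp: bounded_iff)
  have "f \<in> borel_measurable (lebesgue_on T)"
    by (rule continuous_imp_measurable_on_sets_lebesgue[OF assms(2) fmeasurableD[OF T]])
  then show ?thesis
    by (rule measurable_bounded_by_integrable_imp_integrable
        [OF _ integrable_on_const[OF T] B fmeasurableD[OF T]])
qed

section \<open>Step functions on a uniform grid\<close>

lemma step_function_integrable:
  fixes f :: "nat \<Rightarrow> 'b::euclidean_space" and y a b :: real
  assumes "\<And>k. norm (f k) \<le> B"
  shows "(\<lambda>s. f (nat \<lfloor>y * s\<rfloor>)) integrable_on {a..b}"
proof -
  have "(\<lambda>s::real. f (nat \<lfloor>y * s\<rfloor>)) \<in> borel_measurable borel"
    by measurable
  then have "(\<lambda>s. f (nat \<lfloor>y * s\<rfloor>)) \<in> borel_measurable (lebesgue_on {a..b})"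
    by (intro measurable_restrict_space1 measurable_completion) simp
  then show ?thesis
    by (rule measurable_bounded_by_integrable_imp_integrable[where g="\<lambda>_. B"]) (auto simp: assms)
qed

text \<open>The Riemann sum on the right is the displacement after k Euler steps of length 1 / n;
  this identifies the grid values of the integrated polygon with the Euler nodes.\<close>

lemma step_function_integral:
  fixes f :: "nat \<Rightarrow> 'b::euclidean_space"
  assumes "\<And>k. norm (f k) \<le> B" and "0 < n"
  shows "integral {0..real k / real n} (\<lambda>s. f (nat \<lfloor>real n * s\<rfloor>)) = (1 / real n) *\<^sub>R (\<Sum>i<k. f i)"
proof (induction k)
  case (Suc k)
  let ?F = "\<lambda>s. f (nat \<lfloor>real n * s\<rfloor>)"
  let ?a = "real k / real n" and ?b = "real (Suc k) / real n"
  have ab: "0 \<le> ?a" "?a \<le> ?b" using assms(2) by (auto simp: divide_right_mono)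
  \<comment> \<open>The right end point is excluded: there the floor has already jumped to
    \<open>Suc k\<close>.\<close>
  have "?F s = f k" if "s \<in> {?a..?b} - {?b}" for s
  proof -
    have s: "?a \<le> s" "s < ?b" using that by auto
    have "real k \<le> real n * s"
      using s(1) assms(2) by (simp add: pos_divide_le_eq mult.commute)
    moreover have "real n * s < real (Suc k)"
      using s(2) assms(2) by (simp add: pos_less_divide_eq mult.commute)
    ultimately have "\<lfloor>real n * s\<rfloor> = int k" by (intro floor_unique) auto
    then show ?thesis by simp
  qed
  then have "integral {?a..?b} ?F = integral {?a..?b} (\<lambda>_. f k)"
    by (intro integral_spike[of "{?b}"]) auto
  also have "\<dots> = (1 / real n) *\<^sub>R f k"
    using ab by (simp add: diff_divide_distrib[symmetric])
  finally have "integral {?a..?b} ?F = (1 / real n) *\<^sub>R f k" .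
  moreover have "integral {0..?a} ?F + integral {?a..?b} ?F = integral {0..?b} ?F"
    using ab by (intro Henstock_Kurzweil_Integration.integral_combine step_function_integrable[where B=B] assms(1))
  ultimately show ?case using Suc by (simp add: scaleR_add_right)
qed simp

text \<open>The fraction is the last grid point at or before s. For s = 1 the index is n itself, one
  past the last Euler step.\<close>

lemma floor_fraction_bounds:
  fixes n :: nat and s :: real
  assumes "0 < n" "0 \<le> s" "s \<le> 1"
  shows "nat \<lfloor>real n * s\<rfloor> \<le> n" "real (nat \<lfloor>real n * s\<rfloor>) / real n \<le> s"
    "s - real (nat \<lfloor>real n * s\<rfloor>) / real n \<le> 1 / real n"
proof -
  have ns: "0 \<le> real n * s" "real n * s \<le> real n"
    using assms by (auto intro: mult_left_le)
  then have k: "real (nat \<lfloor>real n * s\<rfloor>) \<le> real n * s" "real n * s \<le> real (nat \<lfloor>real n * s\<rfloor>) + 1"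
    by linarith+
  then show "nat \<lfloor>real n * s\<rfloor> \<le> n" using ns by linarith
  show "real (nat \<lfloor>real n * s\<rfloor>) / real n \<le> s"
    using k(1) assms(1) by (simp add: pos_divide_le_eq mult.commute)
  have "s \<le> (real (nat \<lfloor>real n * s\<rfloor>) + 1) / real n"
    using k(2) assms(1) by (simp add: pos_le_divide_eq mult.commute)
  then show "s - real (nat \<lfloor>real n * s\<rfloor>) / real n \<le> 1 / real n"
    by (simp add: add_divide_distrib)
qed

section \<open>Osgood's criterion\<close>

text \<open>Let \<open>U\<close> be the primitive of \<open>w\<close>. Between two consecutive dyadic levels
  \<open>M 2\<^sup>-\<^sup>k\<^sup>-\<^sup>1\<close> and \<open>M 2\<^sup>-\<^sup>k\<close> of \<open>U\<close> the time elapsed is at least a fixed multiple of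
  the integral of \<open>1 / \<phi>\<close> over the level interval, since \<open>U' \<le> K \<phi>(U)\<close>. No chain rule for
  the composition of \<open>U\<close> with the primitive of \<open>1 / \<phi>\<close> is needed.\<close>

lemma osgood:
  fixes \<phi> u w :: "real \<Rightarrow> real"
  assumes mono: "mono_on {0..M} \<phi>" and pos: "\<And>s. 0 < s \<Longrightarrow> s \<le> M \<Longrightarrow> 0 < \<phi> s"
    and div: "filterlim (\<lambda>\<epsilon>. integral {\<epsilon>..M} (\<lambda>s. 1 / \<phi> s)) at_top (at_right 0)"
    and "0 < K" and w: "w integrable_on {0..T}" "\<And>s. s \<in> {0..T} \<Longrightarrow> 0 \<le> w s"
    and wu: "\<And>s. s \<in> {0..T} \<Longrightarrow> w s \<le> K * \<phi> (u s)"
    and u: "\<And>s. s \<in> {0..T} \<Longrightarrow> 0 \<le> u s" "\<And>s. s \<in> {0..T} \<Longrightarrow> u s \<le> M"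
      "\<And>s. s \<in> {0..T} \<Longrightarrow> u s \<le> integral {0..s} w"
    and s: "s \<in> {0..T}"
  shows "u s = 0"
proof (rule ccontr)
  assume "u s \<noteq> 0"
  define U where "U t = integral {0..t} w" for t
  define m where "m = u s"
  have m: "0 < m" "m \<le> M" "m \<le> U s" using u[OF s] \<open>u s \<noteq> 0\<close> by (auto simp: m_def U_def)
  have contU: "continuous_on {0..T} U"
    unfolding U_def by (rule indefinite_integral_continuous_1[OF w(1)])
  have U0: "U 0 = 0" by (simp add: U_def)
  have wsub: "w integrable_on {a..b}" if "0 \<le> a" "b \<le> T" for a b
    using integrable_on_subinterval[OF w(1)] that by auto
  have U_add: "U a + integral {a..b} w = U b" if "0 \<le> a" "a \<le> b" "b \<le> T" for a b
    unfolding U_def using that by (intro Henstock_Kurzweil_Integration.integral_combine wsub) auto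
  have U_mono: "U a \<le> U b" if "0 \<le> a" "a \<le> b" "b \<le> T" for a b
    using U_add[OF that] integral_nonneg[OF wsub[of a b]] w(2) that by fastforce
  \<comment> \<open>On [a, b] the chain u \<le> U \<le> U b and monotonicity of \<phi> bound w by
    the constant \<open>K * \<phi> (U b)\<close>. The condition U b \<le> M keeps the comparison
    where \<phi> is monotone.\<close>
  have U_diff: "U b - U a \<le> K * (b - a) * \<phi> (U b)"
    if "0 \<le> a" "a \<le> b" "b \<le> T" "U b \<le> M" for a b
  proof -
    have "w t \<le> K * \<phi> (U b)" if t: "t \<in> {a..b}" for t
    proof -
      have tT: "t \<in> {0..T}" using t \<open>0 \<le> a\<close> \<open>b \<le> T\<close> by auto
      have "u t \<le> U b"
        using u(3)[OF tT] U_mono[of t b] t \<open>b \<le> T\<close> tT by (auto simp: U_def)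
      then have "\<phi> (u t) \<le> \<phi> (U b)"
        using u(1,2)[OF tT] \<open>U b \<le> M\<close> by (intro mono_onD[OF mono]) auto
      then show ?thesis using wu[OF tT] \<open>0 < K\<close> by (meson mult_left_mono less_imp_le order_trans)
    qed
    then have "integral {a..b} w \<le> integral {a..b} (\<lambda>_. K * \<phi> (U b))"
      using that by (intro integral_le wsub) auto
    then show ?thesis
      using U_add[OF that(1-3)] that by (simp add: algebra_simps)
  qed
  have IVT: "\<exists>t\<in>{0..b}. U t = y" if "b \<in> {0..T}" "0 \<le> y" "y \<le> U b" for b y
    using IVT'[of U 0 y b] that U0 continuous_on_subset[OF contU, of "{0..b}"] by auto
  \<comment> \<open>No continuity of \<phi> is available; 1 / \<phi> is integrable as an antitone
    function, and the sign change makes it monotone.\<close>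
  have phi_int: "(\<lambda>s. 1 / \<phi> s) integrable_on {a..b}" if "0 < a" "b \<le> M" for a b
  proof -
    have "mono_on {a..b} (\<lambda>s. - (1 / \<phi> s))"
    proof (rule mono_onI)
      fix x y assume xy: "x \<in> {a..b}" "y \<in> {a..b}" "x \<le> y"
      then have "\<phi> x \<le> \<phi> y" "0 < \<phi> x"
        using that pos by (auto intro!: mono_onD[OF mono])
      then show "- (1 / \<phi> x) \<le> - (1 / \<phi> y)" by (simp add: frac_le)
    qed
    then have "(\<lambda>s. - (1 / \<phi> s)) integrable_on {a..b}" by (rule integrable_on_mono_on)
    then show ?thesis using integrable_neg by fastforce
  qed
  have phi_le: "integral {a..2 * a} (\<lambda>s. 1 / \<phi> s) \<le> a / \<phi> a" if "0 < a" "2 * a \<le> M" for a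
  proof -
    have "1 / \<phi> x \<le> 1 / \<phi> a" if "x \<in> {a..2*a}" for x
      using that \<open>0 < a\<close> \<open>2 * a \<le> M\<close> pos[of a] by (intro frac_le mono_onD[OF mono]) auto
    then have "integral {a..2 * a} (\<lambda>s. 1 / \<phi> s) \<le> integral {a..2 * a} (\<lambda>_. 1 / \<phi> a)"
      using that by (intro integral_le phi_int) auto
    then show ?thesis using that by simp
  qed
  \<comment> \<open>The time t belongs to the level m / 2^(k+1), one dyadic level below the lower
    limit of the integral. The single value \<phi> a controls both 1 / \<phi> on [a, 2a] and the
    growth of U from a/2 to a; comparing the length a with the gap a/2 gives the factor 2.\<close>
  have levels: "\<exists>t\<in>{0..T}. U t = m / 2 ^ Suc k \<and>
      integral {m / 2 ^ k..M} (\<lambda>s. 1 / \<phi> s) \<le> integral {m..M} (\<lambda>s. 1 / \<phi> s) + 2 * K * (T - t)" for k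
  proof (induction k)
    case 0
    obtain t where "t \<in> {0..s}" "U t = m / 2" using IVT[OF s, of "m / 2"] m by auto
    then show ?case using s \<open>0 < K\<close> by (intro bexI[of _ t]) auto
  next
    case (Suc k)
    define a where "a = m / 2 ^ Suc k"
    have a: "0 < a" "2 * a \<le> M" "m / 2 ^ k = 2 * a" "m / 2 ^ Suc (Suc k) = a / 2"
      using m by (auto simp: a_def field_simps intro: order_trans[OF _ mult_left_mono[of 1 "2 ^ k"]])
    obtain t where t: "t \<in> {0..T}" "U t = a"
      and int: "integral {2 * a..M} (\<lambda>s. 1 / \<phi> s) \<le> integral {m..M} (\<lambda>s. 1 / \<phi> s) + 2 * K * (T - t)"
      using Suc.IH unfolding a(3) a_def[symmetric] by blast
    obtain t' where t': "t' \<in> {0..t}" "U t' = a / 2" using IVT[OF t(1), of "a / 2"] a t by auto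
    have "a / 2 \<le> K * (t - t') * \<phi> a"
      using U_diff[of t' t] t t' a by simp
    then have "a / \<phi> a \<le> 2 * K * (t - t')"
      using pos[of a] a by (simp add: field_simps)
    then have "integral {a..2 * a} (\<lambda>s. 1 / \<phi> s) \<le> 2 * K * (t - t')"
      using phi_le[OF a(1,2)] by simp
    moreover have "integral {a..2 * a} (\<lambda>s. 1 / \<phi> s) + integral {2 * a..M} (\<lambda>s. 1 / \<phi> s)
        = integral {a..M} (\<lambda>s. 1 / \<phi> s)"
      using a by (intro Henstock_Kurzweil_Integration.integral_combine phi_int) auto
    ultimately have "integral {a..M} (\<lambda>s. 1 / \<phi> s) \<le> integral {m..M} (\<lambda>s. 1 / \<phi> s) + 2 * K * (T - t')"
      using int by (simp add: algebra_simps)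
    then show ?case
      unfolding a(4) a_def[symmetric] using t' t(1) by (intro bexI[of _ t']) auto
  qed
  \<comment> \<open>All times in \<open>levels\<close> lie in [0, T], so the integrals from m / 2^k
    to M stay bounded as k grows, against \<open>div\<close>.\<close>
  have "(\<lambda>k. m * (1 / 2) ^ k) \<longlonglongrightarrow> m * 0"
    by (intro tendsto_intros) auto
  then have "(\<lambda>k. m / 2 ^ k) \<longlonglongrightarrow> 0"
    by (simp add: power_one_over)
  moreover have "\<forall>k. m / 2 ^ k \<in> {0<..} \<and> m / 2 ^ k \<noteq> 0"
    using m by simp
  ultimately have "filterlim (\<lambda>k. m / 2 ^ k) (at_right 0) sequentially"
    unfolding filterlim_at by (intro conjI always_eventually)
  then have "filterlim (\<lambda>k. integral {m / 2 ^ k..M} (\<lambda>s. 1 / \<phi> s)) at_top sequentially"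
    by (rule filterlim_compose[OF div])
  then have "\<forall>\<^sub>F k in sequentially.
    integral {m..M} (\<lambda>s. 1 / \<phi> s) + 2 * K * T < integral {m / 2 ^ k..M} (\<lambda>s. 1 / \<phi> s)"
    unfolding filterlim_at_top_dense by blast
  then obtain k :: nat where
    "integral {m..M} (\<lambda>s. 1 / \<phi> s) + 2 * K * T < integral {m / 2 ^ k..M} (\<lambda>s. 1 / \<phi> s)"
    using eventually_happens sequentially_bot by blast
  moreover obtain t where "t \<in> {0..T}"
    "integral {m / 2 ^ k..M} (\<lambda>s. 1 / \<phi> s) \<le> integral {m..M} (\<lambda>s. 1 / \<phi> s) + 2 * K * (T - t)"
    using levels[of k] by blast
  moreover have "2 * K * (T - t) \<le> 2 * K * T"
    using \<open>0 < K\<close> \<open>t \<in> {0..T}\<close> by simp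
  ultimately show False by linarith
qed

section \<open>The modulus of continuity of the velocity field\<close>

locale rectified_flow =
  fixes \<Omega> :: "'a::euclidean_space set" and p0 p1 :: "'a \<Rightarrow> real" and c C :: real
  assumes comp: "compact \<Omega>" and conv: "convex \<Omega>"
    and cont0: "continuous_on \<Omega> p0" and cont1: "continuous_on \<Omega> p1"
    and zero0: "\<And>z. z \<notin> \<Omega> \<Longrightarrow> p0 z = 0" and zero1: "\<And>z. z \<notin> \<Omega> \<Longrightarrow> p1 z = 0"
    and c_pos: "0 < c"
    and lower0: "\<And>z. z \<in> \<Omega> \<Longrightarrow> c \<le> p0 z" and lower1: "\<And>z. z \<in> \<Omega> \<Longrightarrow> c \<le> p1 z"
    and upper0: "\<And>z. p0 z \<le> C" and upper1: "\<And>z. p1 z \<le> C"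
begin

abbreviation S where "S \<equiv> rf_S \<Omega>"
abbreviation v where "v \<equiv> rf_v p0 p1 \<Omega>"
abbreviation \<omega> where "\<omega> \<equiv> rf_omega p0 p1 \<Omega>"
abbreviation D where "D \<equiv> diameter \<Omega>"

text \<open>Up to normalisation, the conditional density of X_1 - X_0 at \<delta> given that the
  interpolant is z: the endpoints are then z - t \<delta> and z + (1 - t) \<delta>.\<close>

definition q where "q t z \<delta> = p0 (z - t *\<^sub>R \<delta>) * p1 (z + (1 - t) *\<^sub>R \<delta>)"

lemma bounded_domain: "bounded \<Omega>"
  using comp compact_imp_bounded by blast

lemma nonneg0: "0 \<le> p0 z" and nonneg1: "0 \<le> p1 z"
  using zero0[of z] lower0[of z] zero1[of z] lower1[of z] c_pos by force+

lemma C_nonneg: "0 \<le> C"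
  using nonneg0 upper0 order_trans by blast

lemma diam_nonneg: "0 \<le> D"
  using bounded_domain diameter_ge_0 by blast

lemma norm_diff_le_diam: "a \<in> \<Omega> \<Longrightarrow> b \<in> \<Omega> \<Longrightarrow> norm (a - b) \<le> D"
  using diameter_bounded_bound[OF bounded_domain] by (metis dist_norm)

text \<open>Here \<delta> is the difference of its two endpoints, both of which lie in
  \<Omega>.\<close>

lemma norm_le_diam: "\<delta> \<in> S t z \<Longrightarrow> norm \<delta> \<le> D"
  using norm_diff_le_diam[of "z + (1 - t) *\<^sub>R \<delta>" "z - t *\<^sub>R \<delta>"]
  by (auto simp: rf_S_def scaleR_diff_left)

section \<open>Geometry of the sets of admissible displacements\<close>

lemma S_eq_vimage: "S t z = (\<lambda>\<delta>. z - t *\<^sub>R \<delta>) -` \<Omega> \<inter> (\<lambda>\<delta>. z + (1 - t) *\<^sub>R \<delta>) -` \<Omega>"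
  by (auto simp: rf_S_def)

lemma closed_S: "closed (S t z)"
  unfolding S_eq_vimage using comp
  by (intro closed_Int continuous_closed_vimage compact_imp_closed continuous_intros) auto

lemma compact_S: "compact (S t z)"
  using closed_S norm_le_diam[of _ t z]
  by (auto simp: compact_eq_bounded_closed bounded_iff)

lemma convex_S: "convex (S t z)"
proof (rule convexI)
  fix x y :: 'a and a b :: real
  assume x: "x \<in> S t z" and y: "y \<in> S t z" and ab: "0 \<le> a" "0 \<le> b" "a + b = 1"
  have z: "z = a *\<^sub>R z + b *\<^sub>R z"
    using ab by (metis scaleR_add_left scaleR_one)
  have "a *\<^sub>R (z - t *\<^sub>R x) + b *\<^sub>R (z - t *\<^sub>R y) \<in> \<Omega>"
    using x y ab conv by (auto simp: rf_S_def intro!: convexD)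
  moreover have "a *\<^sub>R (z + (1 - t) *\<^sub>R x) + b *\<^sub>R (z + (1 - t) *\<^sub>R y) \<in> \<Omega>"
    using x y ab conv by (auto simp: rf_S_def intro!: convexD)
  moreover have "a *\<^sub>R (z - t *\<^sub>R x) + b *\<^sub>R (z - t *\<^sub>R y) = z - t *\<^sub>R (a *\<^sub>R x + b *\<^sub>R y)"
    by (subst (3) z) (simp add: algebra_simps)
  moreover have "a *\<^sub>R (z + (1 - t) *\<^sub>R x) + b *\<^sub>R (z + (1 - t) *\<^sub>R y)
      = z + (1 - t) *\<^sub>R (a *\<^sub>R x + b *\<^sub>R y)"
    by (subst (3) z) (simp add: algebra_simps)
  ultimately show "a *\<^sub>R x + b *\<^sub>R y \<in> S t z"
    by (simp add: rf_S_def)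
qed

lemma lmeasurable_S: "S t z \<in> lmeasurable"
  using compact_S lmeasurable_compact by blast

lemma cball_subset_S:
  assumes "cball z r \<subseteq> \<Omega>" "t \<in> {0..1}"
  shows "cball 0 r \<subseteq> S t z"
proof
  fix \<delta> :: 'a assume "\<delta> \<in> cball 0 r"
  then have d: "norm \<delta> \<le> r" by simp
  have "norm (t *\<^sub>R \<delta>) \<le> r" "norm ((1 - t) *\<^sub>R \<delta>) \<le> r"
    using assms(2) d norm_ge_zero[of \<delta>] mult_left_le_one_le[of "norm \<delta>" t]
      mult_left_le_one_le[of "norm \<delta>" "1 - t"] by auto
  then have "z - t *\<^sub>R \<delta> \<in> cball z r" "z + (1 - t) *\<^sub>R \<delta> \<in> cball z r"
    by (auto simp: dist_norm)
  then show "\<delta> \<in> S t z"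
    using assms(1) by (auto simp: rf_S_def)
qed

text \<open>Passing from (t, z) to (t', z') translates both endpoints of \<delta> by the same vector
  e, of norm at most \<eta>. Shrinking \<delta> leaves room to absorb e by a convex combination with
  a point of the ball about z'.\<close>

lemma scale_S_subset:
  assumes ball: "cball z' r \<subseteq> \<Omega>" and "0 < r" "0 < \<eta>"
    and near: "norm (z - z') + D * \<bar>t - t'\<bar> \<le> \<eta>" and d: "\<delta> \<in> S t z"
  shows "(r / (\<eta> + r)) *\<^sub>R \<delta> \<in> S t' z'"
proof -
  define \<kappa> where "\<kappa> = r / (\<eta> + r)"
  have k: "0 < \<kappa>" "\<kappa> < 1" "1 - \<kappa> = \<eta> / (\<eta> + r)"
    using assms by (auto simp: \<kappa>_def field_simps)
  define e where "e = z' - z + (t - t') *\<^sub>R \<delta>"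
  have "norm e \<le> norm (z - z') + D * \<bar>t - t'\<bar>"
    unfolding e_def using norm_le_diam[OF d]
    by (intro norm_triangle_le) (simp add: norm_minus_commute mult.commute mult_right_mono)
  then have e: "norm e \<le> \<eta>" using near by simp
  \<comment> \<open>The length is the largest that the ball allows when e has norm \<eta>, and (1 -
    \<kappa>) (r / \<eta>) = \<kappa>, so that weighting y by 1 - \<kappa> contributes exactly
    \<open>\<kappa> *\<^sub>R e\<close>.\<close>
  define y where "y = z' + (r / \<eta>) *\<^sub>R e"
  have "y \<in> cball z' r"
    using e assms(2,3) by (simp add: y_def dist_norm field_simps)
  then have y: "y \<in> \<Omega>" using ball by blast
  have ky: "(1 - \<kappa>) *\<^sub>R y = (1 - \<kappa>) *\<^sub>R z' + \<kappa> *\<^sub>R e"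
    using assms(2,3) by (simp add: y_def k(3) scaleR_add_right) (simp add: \<kappa>_def)
  have d0: "z - t *\<^sub>R \<delta> \<in> \<Omega>" and d1: "z + (1 - t) *\<^sub>R \<delta> \<in> \<Omega>"
    using d by (auto simp: rf_S_def)
  have "\<kappa> *\<^sub>R (z - t *\<^sub>R \<delta>) + (1 - \<kappa>) *\<^sub>R y \<in> \<Omega>"
    using d0 y k conv by (intro convexD) auto
  moreover have "\<kappa> *\<^sub>R (z - t *\<^sub>R \<delta>) + (1 - \<kappa>) *\<^sub>R y = z' - t' *\<^sub>R (\<kappa> *\<^sub>R \<delta>)"
    unfolding ky e_def by (simp add: algebra_simps)
  moreover have "\<kappa> *\<^sub>R (z + (1 - t) *\<^sub>R \<delta>) + (1 - \<kappa>) *\<^sub>R y \<in> \<Omega>"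
    using d1 y k conv by (intro convexD) auto
  moreover have "\<kappa> *\<^sub>R (z + (1 - t) *\<^sub>R \<delta>) + (1 - \<kappa>) *\<^sub>R y = z' + (1 - t') *\<^sub>R (\<kappa> *\<^sub>R \<delta>)"
    unfolding ky e_def by (simp add: algebra_simps)
  ultimately show ?thesis
    by (simp add: rf_S_def \<kappa>_def)
qed

text \<open>The part of S t z outside S t' z' lies outside the scaled copy \<kappa> S t z, whose
  measure falls short of that of S t z only by the factor \<kappa>^d, d being the dimension.\<close>

lemma measure_S_diff:
  assumes ball': "cball z' r \<subseteq> \<Omega>" and ball: "cball z r \<subseteq> \<Omega>" and t: "t \<in> {0..1}"
    and "0 < r" "0 < \<eta>" and near: "norm (z - z') + D * \<bar>t - t'\<bar> \<le> \<eta>"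
  shows "measure lebesgue (S t z - S t' z') \<le> real DIM('a) * (\<eta> / r) * measure lebesgue (cball (0::'a) D)"
proof -
  define \<kappa> where "\<kappa> = r / (\<eta> + r)"
  have k: "0 < \<kappa>" "\<kappa> < 1" "1 - \<kappa> = \<eta> / (\<eta> + r)"
    using assms by (auto simp: \<kappa>_def field_simps)
  let ?T = "(*\<^sub>R) \<kappa> ` S t z"
  \<comment> \<open>With 0 in this convex set, the scaled copy lies inside it, so the measure of the
    difference is the difference of the measures.\<close>
  have "0 \<in> S t z"
    using cball_subset_S[OF ball t] \<open>0 < r\<close> by (auto simp: subset_iff)
  then have TS: "?T \<subseteq> S t z"
    using k convexD[OF convex_S, of _ t z 0 \<kappa> "1 - \<kappa>"] by force
  have TS': "?T \<subseteq> S t' z'"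
    using scale_S_subset[OF ball' assms(4,5) near] by (auto simp: \<kappa>_def)
  have T: "?T \<in> lmeasurable"
    using compact_S by (intro lmeasurable_compact compact_scaling)
  have mT: "measure lebesgue ?T = \<kappa> ^ DIM('a) * measure lebesgue (S t z)"
    using measure_lebesgue_affine[of \<kappa> 0 "S t z"] k by simp
  \<comment> \<open>Bernoulli's inequality makes the loss 1 - \<kappa>^d linear in 1 - \<kappa>,
    hence in \<eta>.\<close>
  have bern: "1 - real DIM('a) * (1 - \<kappa>) \<le> \<kappa> ^ DIM('a)"
    using Bernoulli_inequality[of "\<kappa> - 1" "DIM('a)"] k by (simp add: algebra_simps)
  have "measure lebesgue (S t z - S t' z') \<le> measure lebesgue (S t z - ?T)"
    using TS' T lmeasurable_S by (intro measure_mono_fmeasurable) (auto intro: fmeasurable.Diff fmeasurableD)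
  also have "\<dots> = measure lebesgue (S t z) - measure lebesgue ?T"
    using T TS lmeasurable_S by (intro measurable_measure_Diff) (auto intro: fmeasurableD)
  also have "\<dots> = (1 - \<kappa> ^ DIM('a)) * measure lebesgue (S t z)"
    by (simp add: mT algebra_simps)
  also have "\<dots> \<le> (real DIM('a) * (1 - \<kappa>)) * measure lebesgue (cball (0::'a) D)"
    using bern norm_le_diam[of _ t z] lmeasurable_S k assms(4,5)
    by (intro mult_mono measure_mono_fmeasurable) (auto intro: fmeasurableD)
  also have "\<dots> \<le> (real DIM('a) * (\<eta> / r)) * measure lebesgue (cball (0::'a) D)"
    unfolding k(3) using assms(4,5) by (intro mult_right_mono mult_left_mono divide_left_mono) auto
  finally show ?thesis .
qed

section \<open>The weight q, its mass and its mean\<close>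

lemma q_nonneg: "0 \<le> q t z \<delta>"
  using nonneg0 nonneg1 by (simp add: q_def)

lemma q_le: "q t z \<delta> \<le> C\<^sup>2"
  using nonneg0 nonneg1 upper0 upper1 C_nonneg
  by (auto simp: q_def power2_eq_square intro!: mult_mono)

lemma q_outside: "\<delta> \<notin> S t z \<Longrightarrow> q t z \<delta> = 0"
  using zero0 zero1 by (auto simp: q_def rf_S_def)

lemma q_ge: "\<delta> \<in> S t z \<Longrightarrow> c\<^sup>2 \<le> q t z \<delta>"
  using lower0 lower1 c_pos nonneg0
  by (auto simp: q_def rf_S_def power2_eq_square intro!: mult_mono)

lemma continuous_q: "continuous_on (S t z) (q t z)"
  unfolding q_def
  by (intro continuous_intros continuous_on_compose2[OF cont0] continuous_on_compose2[OF cont1])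
     (auto simp: rf_S_def)

lemma q_integrable: "q t z integrable_on S t z"
  and q_times_integrable: "(\<lambda>\<delta>. q t z \<delta> *\<^sub>R \<delta>) integrable_on S t z"
  by (intro integrable_on_compact compact_S continuous_intros continuous_q)+

text \<open>Since q vanishes off S t z, weights belonging to different (t, z) can be subtracted
  under one integral over the whole space.\<close>

lemma q_integrable_UNIV: "q t z integrable_on UNIV"
  and q_integral_UNIV: "integral UNIV (q t z) = integral (S t z) (q t z)"
  and q_times_integrable_UNIV: "(\<lambda>\<delta>. q t z \<delta> *\<^sub>R \<delta>) integrable_on UNIV"
  and q_times_integral_UNIV:
    "integral UNIV (\<lambda>\<delta>. q t z \<delta> *\<^sub>R \<delta>) = integral (S t z) (\<lambda>\<delta>. q t z \<delta> *\<^sub>R \<delta>)"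
proof -
  have 1: "q t z = (\<lambda>\<delta>. if \<delta> \<in> S t z then q t z \<delta> else 0)"
    using q_outside by auto
  have 2: "(\<lambda>\<delta>. q t z \<delta> *\<^sub>R \<delta>) = (\<lambda>\<delta>. if \<delta> \<in> S t z then q t z \<delta> *\<^sub>R \<delta> else 0)"
    using q_outside by auto
  show "q t z integrable_on UNIV"
    by (subst 1) (simp add: integrable_restrict_UNIV q_integrable)
  show "(\<lambda>\<delta>. q t z \<delta> *\<^sub>R \<delta>) integrable_on UNIV"
    by (subst 2) (simp add: integrable_restrict_UNIV q_times_integrable)
  show "integral UNIV (q t z) = integral (S t z) (q t z)"
    by (subst 1) (simp add: integral_restrict_UNIV)
  show "integral UNIV (\<lambda>\<delta>. q t z \<delta> *\<^sub>R \<delta>) = integral (S t z) (\<lambda>\<delta>. q t z \<delta> *\<^sub>R \<delta>)"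
    by (subst 2) (simp add: integral_restrict_UNIV)
qed

lemma v_eq: "v t z = (1 / integral (S t z) (q t z)) *\<^sub>R integral (S t z) (\<lambda>\<delta>. q t z \<delta> *\<^sub>R \<delta>)"
  unfolding rf_v_def q_def ..

text \<open>A lower bound for the denominator of v, uniform over all times and all points at depth
  r; it holds because S t z contains a ball of radius r on which q is at least
  \<open>c\<^sup>2\<close>.\<close>

lemma mass_ge:
  assumes "cball z r \<subseteq> \<Omega>" "t \<in> {0..1}"
  shows "c\<^sup>2 * measure lebesgue (cball (0::'a) r) \<le> integral (S t z) (q t z)"
proof -
  have "c\<^sup>2 * measure lebesgue (cball (0::'a) r) \<le> c\<^sup>2 * measure lebesgue (S t z)"
    using cball_subset_S[OF assms] lmeasurable_S
    by (intro mult_left_mono measure_mono_fmeasurable) (auto intro: fmeasurableD)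
  also have "\<dots> = integral (S t z) (\<lambda>_. c\<^sup>2)"
    using lmeasure_integral[OF lmeasurable_S, of t z] integral_mult_right[of "S t z" "c\<^sup>2" "\<lambda>_. 1"] by simp
  also have "\<dots> \<le> integral (S t z) (q t z)"
    using q_ge q_integrable integrable_on_const[OF lmeasurable_S]
    by (intro integral_le) auto
  finally show ?thesis .
qed

lemma measure_cball_pos: "0 < r \<Longrightarrow> 0 < measure lebesgue (cball (0::'a) r)"
  by (simp add: content_cball)

lemma mass_pos:
  assumes "cball z r \<subseteq> \<Omega>" "0 < r" "t \<in> {0..1}"
  shows "0 < integral (S t z) (q t z)"
  using mass_ge[OF assms(1,3)] measure_cball_pos[OF assms(2)] c_pos
  by (meson less_le_trans mult_pos_pos zero_less_power)

text \<open>A mean of points of the closed convex set \<^term>\<open>S t z\<close> stays in it; hence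
  \<^term>\<open>z + (1 - t) *\<^sub>R v t z\<close> lies in \<open>\<Omega>\<close>.\<close>

lemma v_in_S:
  assumes "cball z r \<subseteq> \<Omega>" "0 < r" "t \<in> {0..1}"
  shows "v t z \<in> S t z"
proof (rule ccontr)
  assume "v t z \<notin> S t z"
  then obtain a b where ab: "a \<bullet> v t z < b" "\<And>x. x \<in> S t z \<Longrightarrow> b < a \<bullet> x"
    using separating_hyperplane_closed_point[OF convex_S closed_S] by blast
  let ?Z = "integral (S t z) (q t z)"
  note pos = mass_pos[OF assms]
  \<comment> \<open>Integrating the separation b < a \<bullet> \<delta> against q gives b \<le> a
    \<bullet> v t z, contrary to the choice of the hyperplane.\<close>
  have "b * ?Z = integral (S t z) (\<lambda>\<delta>. b * q t z \<delta>)"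
    by simp
  also have "\<dots> \<le> integral (S t z) (\<lambda>\<delta>. a \<bullet> (q t z \<delta> *\<^sub>R \<delta>))"
  proof (rule integral_le)
    show "(\<lambda>\<delta>. b * q t z \<delta>) integrable_on S t z"
      using integrable_cmul[OF q_integrable, of b] by simp
    show "(\<lambda>\<delta>. a \<bullet> (q t z \<delta> *\<^sub>R \<delta>)) integrable_on S t z"
      using integrable_linear[OF q_times_integrable bounded_linear_inner_right[of a]]
      by (simp add: o_def)
    show "b * q t z \<delta> \<le> a \<bullet> (q t z \<delta> *\<^sub>R \<delta>)" if "\<delta> \<in> S t z" for \<delta>
      using mult_right_mono[OF less_imp_le[OF ab(2)[OF that]] q_nonneg] by (simp add: mult.commute)
  qed
  also have "\<dots> = a \<bullet> integral (S t z) (\<lambda>\<delta>. q t z \<delta> *\<^sub>R \<delta>)"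
    using integral_linear[OF q_times_integrable bounded_linear_inner_right[of a]] by (simp add: o_def)
  also have "\<dots> = (a \<bullet> v t z) * ?Z"
    using pos by (simp add: v_eq)
  finally show False
    using ab(1) pos by simp
qed

lemma norm_v_le:
  assumes "cball z r \<subseteq> \<Omega>" "0 < r" "t \<in> {0..1}"
  shows "norm (v t z) \<le> D"
  using norm_le_diam v_in_S assms by blast

section \<open>The relative oscillation \<omega> of the densities\<close>

lemma omega_bdd_above:
  "bdd_above ((\<lambda>zz. max \<bar>p0 (fst zz) / p0 (snd zz) - 1\<bar> \<bar>p1 (fst zz) / p1 (snd zz) - 1\<bar>) `
     {(z, z'). z \<in> \<Omega> \<and> z' \<in> \<Omega> \<and> norm (z - z') \<le> \<eta>})"
proof (rule bdd_aboveI2)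
  fix zz assume "zz \<in> {(z, z'). z \<in> \<Omega> \<and> z' \<in> \<Omega> \<and> norm (z - z') \<le> \<eta>}"
  then have zz: "snd zz \<in> \<Omega>" by auto
  have "p0 (fst zz) / p0 (snd zz) \<le> C / c" "p1 (fst zz) / p1 (snd zz) \<le> C / c"
    using zz c_pos lower0 lower1 nonneg0 nonneg1 upper0 upper1 C_nonneg
    by (auto intro!: frac_le)
  moreover have "0 \<le> p0 (fst zz) / p0 (snd zz)" "0 \<le> p1 (fst zz) / p1 (snd zz)"
    using nonneg0 nonneg1 by auto
  ultimately show "max \<bar>p0 (fst zz) / p0 (snd zz) - 1\<bar> \<bar>p1 (fst zz) / p1 (snd zz) - 1\<bar> \<le> C / c + 1"
    by auto
qed

text \<open>A real-valued supremum dominates the members of its family once the family is bounded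
  above, which \<open>omega_bdd_above\<close> supplies.\<close>

lemma ratio_le_omega:
  assumes "a \<in> \<Omega>" "b \<in> \<Omega>" "norm (a - b) \<le> \<eta>"
  shows "\<bar>p0 a / p0 b - 1\<bar> \<le> \<omega> \<eta>" "\<bar>p1 a / p1 b - 1\<bar> \<le> \<omega> \<eta>"
proof -
  have "max \<bar>p0 a / p0 b - 1\<bar> \<bar>p1 a / p1 b - 1\<bar> \<le> \<omega> \<eta>"
    unfolding rf_omega_def
    by (rule cSUP_upper2[OF omega_bdd_above, where x="(a, b)"]) (use assms in auto)
  then show "\<bar>p0 a / p0 b - 1\<bar> \<le> \<omega> \<eta>" "\<bar>p1 a / p1 b - 1\<bar> \<le> \<omega> \<eta>"
    by auto
qed

lemma omega_nonneg:
  assumes "\<Omega> \<noteq> {}" "0 \<le> \<eta>"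
  shows "0 \<le> \<omega> \<eta>"
proof -
  obtain a where "a \<in> \<Omega>" using assms by blast
  then have "\<bar>p0 a / p0 a - 1\<bar> \<le> \<omega> \<eta>" using assms by (intro ratio_le_omega) auto
  then show ?thesis by linarith
qed

lemma diff_le_omega:
  assumes "a \<in> \<Omega>" "b \<in> \<Omega>" "norm (a - b) \<le> \<eta>"
  shows "\<bar>p0 a - p0 b\<bar> \<le> C * \<omega> \<eta>" "\<bar>p1 a - p1 b\<bar> \<le> C * \<omega> \<eta>"
proof -
  have "\<bar>p0 a - p0 b\<bar> = p0 b * \<bar>p0 a / p0 b - 1\<bar>" "\<bar>p1 a - p1 b\<bar> = p1 b * \<bar>p1 a / p1 b - 1\<bar>"
    using lower0[OF assms(2)] lower1[OF assms(2)] c_pos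
    by (auto simp: abs_if field_simps)
  moreover have "p0 b * \<bar>p0 a / p0 b - 1\<bar> \<le> C * \<omega> \<eta>" "p1 b * \<bar>p1 a / p1 b - 1\<bar> \<le> C * \<omega> \<eta>"
    using ratio_le_omega[OF assms] upper0 upper1 C_nonneg by (auto intro!: mult_mono)
  ultimately show "\<bar>p0 a - p0 b\<bar> \<le> C * \<omega> \<eta>" "\<bar>p1 a - p1 b\<bar> \<le> C * \<omega> \<eta>" by auto
qed

text \<open>Uniform continuity on the compact \<Omega> controls absolute differences, and the lower
  bound c turns them into relative ones.\<close>

lemma omega_tendsto_0:
  assumes "\<Omega> \<noteq> {}"
  shows "(\<omega> \<longlongrightarrow> 0) (at_right 0)"
proof (rule tendstoI)
  fix e :: real assume "0 < e"
  \<comment> \<open>The factor c compensates the division by a density; the half keeps the bound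
    below e strict after the supremum is taken.\<close>
  then have ec: "0 < e / 2 * c" using c_pos by simp
  obtain d0 where d0: "d0 > 0" "\<And>a b. a \<in> \<Omega> \<Longrightarrow> b \<in> \<Omega> \<Longrightarrow> dist b a < d0 \<Longrightarrow> dist (p0 b) (p0 a) < e / 2 * c"
    using compact_uniformly_continuous[OF cont0 comp] ec unfolding uniformly_continuous_on_def by meson
  obtain d1 where d1: "d1 > 0" "\<And>a b. a \<in> \<Omega> \<Longrightarrow> b \<in> \<Omega> \<Longrightarrow> dist b a < d1 \<Longrightarrow> dist (p1 b) (p1 a) < e / 2 * c"
    using compact_uniformly_continuous[OF cont1 comp] ec unfolding uniformly_continuous_on_def by meson
  have "\<bar>\<omega> \<eta>\<bar> < e" if "0 < \<eta>" "\<eta> < min d0 d1" for \<eta>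
  proof -
    have ratio: "\<bar>x / y - 1\<bar> \<le> e / 2" if "c \<le> y" "\<bar>x - y\<bar> < e / 2 * c" for x y
    proof -
      have "\<bar>x / y - 1\<bar> = \<bar>x - y\<bar> / y"
        using that c_pos by (simp add: abs_if field_simps)
      also have "\<dots> \<le> (e / 2 * c) / c"
        using that c_pos \<open>0 < e\<close> by (intro frac_le) auto
      finally show ?thesis using c_pos by simp
    qed
    have "\<omega> \<eta> \<le> e / 2"
      unfolding rf_omega_def
    proof (rule cSUP_least)
      show "{(z, z'). z \<in> \<Omega> \<and> z' \<in> \<Omega> \<and> norm (z - z') \<le> \<eta>} \<noteq> {}"
        using assms that by fastforce
      fix zz assume "zz \<in> {(z, z'). z \<in> \<Omega> \<and> z' \<in> \<Omega> \<and> norm (z - z') \<le> \<eta>}"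
      then have zz: "fst zz \<in> \<Omega>" "snd zz \<in> \<Omega>" "dist (fst zz) (snd zz) \<le> \<eta>"
        by (auto simp: dist_norm)
      then show "max \<bar>p0 (fst zz) / p0 (snd zz) - 1\<bar> \<bar>p1 (fst zz) / p1 (snd zz) - 1\<bar> \<le> e / 2"
        using that ratio[OF lower0[OF zz(2)], of "p0 (fst zz)"] ratio[OF lower1[OF zz(2)], of "p1 (fst zz)"]
          d0(2)[OF zz(2,1)] d1(2)[OF zz(2,1)] by (auto simp: dist_real_def)
    qed
    then show ?thesis using \<open>0 < e\<close> omega_nonneg[OF assms, of \<eta>] that by linarith
  qed
  then show "\<forall>\<^sub>F \<eta> in at_right 0. dist (\<omega> \<eta>) 0 < e"
    unfolding eventually_at_right_field using d0(1) d1(1)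
    by (intro exI[of _ "min d0 d1"]) auto
qed

section \<open>Comparison of velocities at nearby times and points\<close>

lemma q_diff_le:
  assumes "\<delta> \<in> S t z" "\<delta> \<in> S t' z'" and near: "norm (z - z') + D * \<bar>t - t'\<bar> \<le> \<eta>"
  shows "\<bar>q t z \<delta> - q t' z' \<delta>\<bar> \<le> 2 * C\<^sup>2 * \<omega> \<eta>"
proof -
  let ?a = "z - t *\<^sub>R \<delta>" and ?b = "z + (1 - t) *\<^sub>R \<delta>"
  let ?a' = "z' - t' *\<^sub>R \<delta>" and ?b' = "z' + (1 - t') *\<^sub>R \<delta>"
  have dom: "?a \<in> \<Omega>" "?b \<in> \<Omega>" "?a' \<in> \<Omega>" "?b' \<in> \<Omega>"
    using assms(1,2) by (auto simp: rf_S_def)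
  \<comment> \<open>This vector is the common displacement of both endpoints, so one estimate serves
    \<open>p0\<close> and \<open>p1\<close>.\<close>
  have "norm ((z - z') - (t - t') *\<^sub>R \<delta>) \<le> norm (z - z') + norm ((t - t') *\<^sub>R \<delta>)"
    by (rule norm_triangle_ineq4)
  also have "\<dots> \<le> \<eta>"
    using near mult_right_mono[OF norm_le_diam[OF assms(1)], of "\<bar>t - t'\<bar>"] by (simp add: mult.commute)
  finally have n: "norm ((z - z') - (t - t') *\<^sub>R \<delta>) \<le> \<eta>" .
  have "?a - ?a' = (z - z') - (t - t') *\<^sub>R \<delta>" "?b - ?b' = (z - z') - (t - t') *\<^sub>R \<delta>"
    by (simp_all add: algebra_simps)
  with n have n: "norm (?a - ?a') \<le> \<eta>" "norm (?b - ?b') \<le> \<eta>" by (simp_all only:)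
  have "q t z \<delta> - q t' z' \<delta> = (p0 ?a - p0 ?a') * p1 ?b + p0 ?a' * (p1 ?b - p1 ?b')"
    by (simp add: q_def algebra_simps)
  also have "\<bar>\<dots>\<bar> \<le> \<bar>p0 ?a - p0 ?a'\<bar> * p1 ?b + p0 ?a' * \<bar>p1 ?b - p1 ?b'\<bar>"
    using abs_triangle_ineq[of "(p0 ?a - p0 ?a') * p1 ?b" "p0 ?a' * (p1 ?b - p1 ?b')"]
      nonneg0[of ?a'] nonneg1[of ?b] by (simp add: abs_mult)
  also have "\<dots> \<le> (C * \<omega> \<eta>) * C + C * (C * \<omega> \<eta>)"
    using diff_le_omega(1)[OF dom(1,3) n(1)] diff_le_omega(2)[OF dom(2,4) n(2)]
      upper0 upper1 nonneg1 nonneg0 C_nonneg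
    by (intro add_mono mult_mono) auto
  finally show ?thesis by (simp add: power2_eq_square algebra_simps)
qed

text \<open>Since the weights \<open>q t z\<close> average \<open>\<delta> - v t z\<close> to zero, the difference of the two
  velocities is the average of \<open>\<delta> - v t' z'\<close> against \<open>q t z - q t' z'\<close>.\<close>

lemma norm_v_diff_mass:
  assumes ball: "cball z r \<subseteq> \<Omega>" and ball': "cball z' r \<subseteq> \<Omega>" and "0 < r" "0 < \<eta>"
    and t: "t \<in> {0..1}" "t' \<in> {0..1}" and near: "norm (z - z') + D * \<bar>t - t'\<bar> \<le> \<eta>"
  shows "norm (v t z - v t' z') * integral (S t z) (q t z)
     \<le> 4 * D * C\<^sup>2 * measure lebesgue (cball (0::'a) D) * (\<omega> \<eta> + real DIM('a) * (\<eta> / r))"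
proof -
  let ?V = "measure lebesgue (cball (0::'a) D)"
  let ?w = "v t' z'"
  define A where "A = integral UNIV (\<lambda>\<delta>. q t z \<delta> *\<^sub>R \<delta>)"
  define A' where "A' = integral UNIV (\<lambda>\<delta>. q t' z' \<delta> *\<^sub>R \<delta>)"
  define Z where "Z = integral UNIV (q t z)"
  define Z' where "Z' = integral UNIV (q t' z')"
  have Z: "0 < Z" "0 < Z'"
    using mass_pos[OF ball \<open>0 < r\<close> t(1)] mass_pos[OF ball' \<open>0 < r\<close> t(2)]
    by (auto simp: Z_def Z'_def q_integral_UNIV)
  have vA: "Z *\<^sub>R v t z = A" "Z' *\<^sub>R ?w = A'"
    using Z by (auto simp: v_eq A_def A'_def Z_def Z'_def q_integral_UNIV q_times_integral_UNIV)
  let ?f = "\<lambda>\<delta>. (q t z \<delta> - q t' z' \<delta>) *\<^sub>R (\<delta> - ?w)"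
  \<comment> \<open>Since \<open>Z' *\<^sub>R ?w = A'\<close>, the two terms of (t', z') cancel and
    Z times the velocity difference remains.\<close>
  have "((\<lambda>\<delta>. (q t z \<delta> *\<^sub>R \<delta> - q t' z' \<delta> *\<^sub>R \<delta>) - (q t z \<delta> *\<^sub>R ?w - q t' z' \<delta> *\<^sub>R ?w))
      has_integral ((A - A') - (Z *\<^sub>R ?w - Z' *\<^sub>R ?w))) UNIV"
    unfolding A_def A'_def Z_def Z'_def
    by (intro has_integral_diff has_integral_scaleR_left integrable_integral
        q_integrable_UNIV q_times_integrable_UNIV)
  then have f: "(?f has_integral (Z *\<^sub>R (v t z - ?w))) UNIV"
    using vA by (simp add: algebra_simps)
  let ?I = "\<lambda>X :: 'a set. indicat_real X"
  \<comment> \<open>The majorant: on the common part the weights differ by at most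
    \<open>2 * C\<^sup>2 * \<omega> \<eta>\<close>, on the symmetric difference only one of them is
    nonzero and it is at most \<open>C\<^sup>2\<close>; 2 D bounds the norm of \<delta> - v t'
    z'.\<close>
  let ?h = "\<lambda>\<delta>. 2 * D * (2 * C\<^sup>2 * \<omega> \<eta> * ?I (S t z) \<delta>
      + C\<^sup>2 * (?I (S t z - S t' z') \<delta> + ?I (S t' z' - S t z) \<delta>))"
  have Om: "\<Omega> \<noteq> {}" using ball \<open>0 < r\<close> by auto
  have meas: "S t z - S t' z' \<in> lmeasurable" "S t' z' - S t z \<in> lmeasurable"
    using lmeasurable_S by (auto intro: fmeasurable.Diff fmeasurableD)
  have ind: "(?I X has_integral measure lebesgue X) UNIV" if "X \<in> lmeasurable" for X
    using that lmeasurable_iff_has_integral by blast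
  have h: "(?h has_integral 2 * D * (2 * C\<^sup>2 * \<omega> \<eta> * measure lebesgue (S t z)
      + C\<^sup>2 * (measure lebesgue (S t z - S t' z') + measure lebesgue (S t' z' - S t z)))) UNIV"
    by (intro has_integral_mult_right has_integral_add ind meas lmeasurable_S)
  have le: "norm (?f \<delta>) \<le> ?h \<delta>" for \<delta>
  proof -
    let ?k = "2 * C\<^sup>2 * \<omega> \<eta> * ?I (S t z) \<delta>
      + C\<^sup>2 * (?I (S t z - S t' z') \<delta> + ?I (S t' z' - S t z) \<delta>)"
    have om: "0 \<le> \<omega> \<eta>" using omega_nonneg[OF Om, of \<eta>] \<open>0 < \<eta>\<close> by simp
    have qk: "\<bar>q t z \<delta> - q t' z' \<delta>\<bar> \<le> ?k"
      using q_diff_le[OF _ _ near, of \<delta>] q_outside[of \<delta> t z] q_outside[of \<delta> t' z']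
        q_nonneg[of t z \<delta>] q_nonneg[of t' z' \<delta>] q_le[of t z \<delta>] q_le[of t' z' \<delta>] om
      by (cases "\<delta> \<in> S t z"; cases "\<delta> \<in> S t' z'") (auto simp: mult.assoc intro: add_increasing)
    show ?thesis
    proof (cases "\<delta> \<in> S t z \<or> \<delta> \<in> S t' z'")
      case True
      then have "norm \<delta> \<le> D" using norm_le_diam by blast
      then have "norm (\<delta> - ?w) \<le> 2 * D"
        using norm_v_le[OF ball' \<open>0 < r\<close> t(2)] norm_triangle_ineq4[of \<delta> ?w] by linarith
      then have "\<bar>q t z \<delta> - q t' z' \<delta>\<bar> * norm (\<delta> - ?w) \<le> ?k * (2 * D)"
        using qk by (intro mult_mono) auto
      then show ?thesis by (simp add: mult.commute)
    next
      case False
      then show ?thesis by (simp add: q_outside)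
    qed
  qed
  have SV: "measure lebesgue (S t z) \<le> ?V"
    using norm_le_diam[of _ t z] lmeasurable_S
    by (intro measure_mono_fmeasurable) (auto intro: fmeasurableD)
  have near': "norm (z' - z) + D * \<bar>t' - t\<bar> \<le> \<eta>"
    using near by (simp add: norm_minus_commute abs_minus_commute)
  have "norm (integral UNIV ?f) \<le> integral UNIV ?h"
    using f h le by (intro integral_norm_bound_integral) (auto intro: has_integral_integrable)
  then have "norm (Z *\<^sub>R (v t z - ?w)) \<le> 2 * D * (2 * C\<^sup>2 * \<omega> \<eta> * measure lebesgue (S t z)
      + C\<^sup>2 * (measure lebesgue (S t z - S t' z') + measure lebesgue (S t' z' - S t z)))"
    by (simp only: integral_unique[OF f] integral_unique[OF h])
  also have "\<dots> \<le> 2 * D * (2 * C\<^sup>2 * \<omega> \<eta> * ?V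
      + C\<^sup>2 * (real DIM('a) * (\<eta> / r) * ?V + real DIM('a) * (\<eta> / r) * ?V))"
    using SV measure_S_diff[OF ball' ball t(1) \<open>0 < r\<close> \<open>0 < \<eta>\<close> near]
      measure_S_diff[OF ball ball' t(2) \<open>0 < r\<close> \<open>0 < \<eta>\<close> near']
      omega_nonneg[OF Om, of \<eta>] \<open>0 < \<eta>\<close> diam_nonneg
    by (intro mult_left_mono add_mono) auto
  also have "\<dots> = 4 * D * C\<^sup>2 * ?V * (\<omega> \<eta> + real DIM('a) * (\<eta> / r))"
    by (simp add: algebra_simps)
  finally show ?thesis
    using Z by (simp add: Z_def q_integral_UNIV mult.commute)
qed

text \<open>Dividing the previous estimate by the uniform lower bound for the mass leaves a constant
  that depends on the depth r but not on the points or times.\<close>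

lemma v_modulus:
  assumes "0 < r"
  obtains K where "0 < K" and
    "\<And>t t' z z' \<eta>. \<lbrakk>cball z r \<subseteq> \<Omega>; cball z' r \<subseteq> \<Omega>; t \<in> {0..1}; t' \<in> {0..1}; 0 < \<eta>;
        norm (z - z') + D * \<bar>t - t'\<bar> \<le> \<eta>\<rbrakk> \<Longrightarrow> norm (v t z - v t' z') \<le> K * (\<eta> + \<omega> \<eta>)"
proof -
  define B where "B = 4 * D * C\<^sup>2 * measure lebesgue (cball (0::'a) D)"
  define m where "m = c\<^sup>2 * measure lebesgue (cball (0::'a) r)"
  \<comment> \<open>The maximum lets one constant dominate the coefficients of both \<omega> \<eta>
    and \<eta>.\<close>
  define L where "L = max 1 (real DIM('a) / r)"
  have B: "0 \<le> B" using diam_nonneg by (simp add: B_def)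
  have m: "0 < m" using c_pos measure_cball_pos[OF assms] by (simp add: m_def)
  have L: "1 \<le> L" "real DIM('a) / r \<le> L" by (auto simp: L_def)
  show ?thesis
  proof
    \<comment> \<open>Only 0 \<le> B has been established, so adding 1 secures a positive
      constant.\<close>
    show "0 < B * L / m + 1" using B m L by (auto intro!: add_nonneg_pos)
    fix t t' z z' \<eta>
    assume a: "cball z r \<subseteq> \<Omega>" "cball z' r \<subseteq> \<Omega>" "t \<in> {0..1}" "t' \<in> {0..1}" "0 < \<eta>"
        "norm (z - z') + D * \<bar>t - t'\<bar> \<le> \<eta>"
    have Om: "\<Omega> \<noteq> {}" using a(1) assms by auto
    have om: "0 \<le> \<omega> \<eta>" using omega_nonneg[OF Om, of \<eta>] a(5) by simp
    have "norm (v t z - v t' z') * m \<le> norm (v t z - v t' z') * integral (S t z) (q t z)"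
      using mass_ge[OF a(1,3)] by (intro mult_left_mono) (auto simp: m_def)
    also have "\<dots> \<le> B * (\<omega> \<eta> + real DIM('a) * (\<eta> / r))"
      using norm_v_diff_mass[OF a(1,2) assms a(5,3,4,6)] by (simp add: B_def)
    also have "\<dots> \<le> B * (L * \<omega> \<eta> + L * \<eta>)"
      using B L om a(5) mult_right_mono[OF L(2), of \<eta>] mult_right_mono[OF L(1) om]
      by (intro mult_left_mono add_mono) auto
    finally have "norm (v t z - v t' z') \<le> B * L / m * (\<eta> + \<omega> \<eta>)"
      using m by (simp add: field_simps)
    also have "\<dots> \<le> (B * L / m + 1) * (\<eta> + \<omega> \<eta>)"
      using om a(5) by (intro mult_right_mono) auto
    finally show "norm (v t z - v t' z') \<le> (B * L / m + 1) * (\<eta> + \<omega> \<eta>)" .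
  qed
qed

lemma v_tendsto:
  assumes "0 < r" "cball z r \<subseteq> \<Omega>" "t \<in> {0..1}"
    and "\<And>n. cball (zs n) r \<subseteq> \<Omega>" "\<And>n. ts n \<in> {0..1}"
    and "zs \<longlonglongrightarrow> z" "ts \<longlonglongrightarrow> t"
  shows "(\<lambda>n::nat. v (ts n) (zs n)) \<longlonglongrightarrow> v t z"
proof -
  obtain K where K: "\<And>t t' z z' \<eta>. \<lbrakk>cball z r \<subseteq> \<Omega>; cball z' r \<subseteq> \<Omega>; t \<in> {0..1}; t' \<in> {0..1}; 0 < \<eta>;
        norm (z - z') + D * \<bar>t - t'\<bar> \<le> \<eta>\<rbrakk> \<Longrightarrow> norm (v t z - v t' z') \<le> K * (\<eta> + \<omega> \<eta>)"
    using v_modulus[OF assms(1)] by metis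
  \<comment> \<open>The last summand keeps \<eta> n strictly positive, as both the modulus and the
    limit of \<omega> from the right require, even when the sequence hits its limit.\<close>
  define \<eta> where "\<eta> n = norm (zs n - z) + D * \<bar>ts n - t\<bar> + inverse (real (Suc n))" for n
  have Om: "\<Omega> \<noteq> {}" using assms(1,2) by auto
  have pos: "0 < \<eta> n" for n
    using diam_nonneg by (auto simp: \<eta>_def intro!: add_nonneg_pos)
  have "(\<lambda>n. norm (zs n - z) + D * \<bar>ts n - t\<bar> + inverse (real (Suc n))) \<longlonglongrightarrow> norm (z - z) + D * \<bar>t - t\<bar> + 0"
    by (intro tendsto_intros assms LIMSEQ_inverse_real_of_nat)
  then have eta: "\<eta> \<longlonglongrightarrow> 0" by (simp add: \<eta>_def[abs_def])
  then have "filterlim \<eta> (at_right 0) sequentially"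
    unfolding filterlim_at using pos by (auto intro!: always_eventually simp: less_le)
  then have "(\<lambda>n. \<omega> (\<eta> n)) \<longlonglongrightarrow> 0"
    by (rule filterlim_compose[OF omega_tendsto_0[OF Om]])
  then have "(\<lambda>n. K * (\<eta> n + \<omega> (\<eta> n))) \<longlonglongrightarrow> K * (0 + 0)"
    by (intro tendsto_intros eta)
  then have "(\<lambda>n. K * (\<eta> n + \<omega> (\<eta> n))) \<longlonglongrightarrow> 0" by simp
  moreover have "\<forall>n. norm (v (ts n) (zs n) - v t z) \<le> K * (\<eta> n + \<omega> (\<eta> n))"
    using K[OF assms(4) assms(2) assms(5) assms(3) pos] by (simp add: \<eta>_def)
  ultimately have "(\<lambda>n. v (ts n) (zs n) - v t z) \<longlonglongrightarrow> 0"
    by (rule Lim_null_comparison[OF always_eventually, rotated])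
  then show ?thesis by (rule LIM_zero_cancel)
qed

section \<open>Existence and uniqueness\<close>

primrec euler :: "nat \<Rightarrow> 'a \<Rightarrow> nat \<Rightarrow> 'a" where
  "euler n x 0 = x"
| "euler n x (Suc k) = euler n x k + (1 / real n) *\<^sub>R v (real k / real n) (euler n x k)"

text \<open>An Euler step moves from \<open>z\<close> towards the point \<^term>\<open>z + (1 - t) *\<^sub>R v t z\<close> of \<open>\<Omega>\<close>,
  covering the fraction \<open>h / (1 - t)\<close> of the way, so it shrinks the inscribed radius
  by the factor \<open>(1 - (t + h)) / (1 - t)\<close>.\<close>

lemma euler_cball:
  assumes "cball x r \<subseteq> \<Omega>" "0 < r" "0 < n" "k \<le> n"
  shows "cball (euler n x k) (r * (1 - real k / real n)) \<subseteq> \<Omega>"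
  using \<open>k \<le> n\<close>
proof (induction k)
  case 0
  then show ?case using assms by simp
next
  case (Suc k)
  define t where "t = real k / real n"
  define z where "z = euler n x k"
  define \<mu> where "\<mu> = 1 / (real n * (1 - t))"
  have t: "t \<in> {0..1}" "t < 1"
    using Suc.prems assms(3) by (auto simp: t_def)
  have "real n * (1 - t) = real n - real k"
    using assms(3) by (simp add: t_def right_diff_distrib)
  \<comment> \<open>Since k < n, at least one whole step remains before time 1, so the step does not
    overshoot its target; at the last step \<mu> = 1 and the radius drops to 0.\<close>
  then have nt: "1 \<le> real n * (1 - t)" using Suc.prems by linarith
  have mu: "0 \<le> \<mu>" "\<mu> \<le> 1" using nt by (auto simp: \<mu>_def)
  have ball: "cball z (r * (1 - t)) \<subseteq> \<Omega>" using Suc by (simp add: z_def t_def)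
  have rt: "0 < r * (1 - t)" using t assms by simp
  have "z + (1 - t) *\<^sub>R v t z \<in> \<Omega>"
    using v_in_S[OF ball rt t(1)] by (simp add: rf_S_def)
  from cball_convex_combination_subset[OF conv ball this mu less_imp_le[OF rt]]
  have "cball ((1 - \<mu>) *\<^sub>R z + \<mu> *\<^sub>R (z + (1 - t) *\<^sub>R v t z)) ((1 - \<mu>) * (r * (1 - t))) \<subseteq> \<Omega>" .
  moreover have mt: "\<mu> * (1 - t) = 1 / real n"
    using t assms(3) by (simp add: \<mu>_def field_simps)
  have "(1 - \<mu>) *\<^sub>R z + \<mu> *\<^sub>R (z + (1 - t) *\<^sub>R v t z) = z + (\<mu> * (1 - t)) *\<^sub>R v t z"
    by (simp add: algebra_simps)
  then have "(1 - \<mu>) *\<^sub>R z + \<mu> *\<^sub>R (z + (1 - t) *\<^sub>R v t z) = euler n x (Suc k)"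
    unfolding mt by (simp add: z_def t_def)
  moreover have "(1 - \<mu>) * (r * (1 - t)) = r * (1 - t - \<mu> * (1 - t))"
    by (simp add: algebra_simps)
  then have "(1 - \<mu>) * (r * (1 - t)) = r * (1 - real (Suc k) / real n)"
    unfolding mt by (simp add: t_def add_divide_distrib algebra_simps)
  ultimately show ?case by simp
qed

text \<open>The cut-off at n matters at time 1, where the inscribed radius is 0 and v is not
  controlled. It also gives a bound valid for every index, as the step function lemmas
  demand.\<close>

definition euler_velocity :: "nat \<Rightarrow> 'a \<Rightarrow> nat \<Rightarrow> 'a" where
  "euler_velocity n x k = (if k < n then v (real k / real n) (euler n x k) else 0)"

lemma euler_velocity_le:
  assumes "cball x r \<subseteq> \<Omega>" "0 < r" "0 < n"
  shows "norm (euler_velocity n x k) \<le> D"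
proof (cases "k < n")
  case True
  have "0 < r * (1 - real k / real n)" "real k / real n \<in> {0..1}"
    using True assms by auto
  then show ?thesis
    using norm_v_le[OF euler_cball[OF assms less_imp_le[OF True]]] True
    by (simp add: euler_velocity_def)
qed (simp add: euler_velocity_def diam_nonneg)

text \<open>Writing the polygon as the integral of its step velocity reduces the passage to the
  limit to convergence of integrals.\<close>

definition euler_path :: "nat \<Rightarrow> 'a \<Rightarrow> real \<Rightarrow> 'a" where
  "euler_path n x t = x + integral {0..t} (\<lambda>s. euler_velocity n x (nat \<lfloor>real n * s\<rfloor>))"

lemma euler_path_node:
  assumes "cball x r \<subseteq> \<Omega>" "0 < r" "0 < n" "k \<le> n"
  shows "euler_path n x (real k / real n) = euler n x k"
proof -
  have "euler n x k = x + (1 / real n) *\<^sub>R (\<Sum>i<k. euler_velocity n x i)"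
    using \<open>k \<le> n\<close> by (induction k) (simp_all add: euler_velocity_def scaleR_add_right)
  then show ?thesis
    unfolding euler_path_def
    using step_function_integral[of "euler_velocity n x", OF euler_velocity_le[OF assms(1-3)] assms(3)]
    by simp
qed

lemma euler_path_lipschitz:
  assumes "cball x r \<subseteq> \<Omega>" "0 < r" "0 < n" "0 \<le> s" "0 \<le> t"
  shows "norm (euler_path n x s - euler_path n x t) \<le> D * \<bar>s - t\<bar>"
  using assms(4,5)
proof (induction s t rule: linorder_wlog)
  case (le s t)
  let ?G = "\<lambda>s. euler_velocity n x (nat \<lfloor>real n * s\<rfloor>)"
  note int = step_function_integrable[of "euler_velocity n x", OF euler_velocity_le[OF assms(1-3)]]
  have "integral {0..s} ?G + integral {s..t} ?G = integral {0..t} ?G"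
    using le by (intro Henstock_Kurzweil_Integration.integral_combine int)
  then have "euler_path n x t - euler_path n x s = integral {s..t} ?G"
    by (simp add: euler_path_def algebra_simps)
  moreover have "norm (integral {s..t} ?G) \<le> integral {s..t} (\<lambda>_. D)"
    using euler_velocity_le[OF assms(1-3)] by (intro integral_norm_bound_integral int) auto
  ultimately show ?case
    using le by (simp add: norm_minus_commute[of "euler_path n x s" "euler_path n x t"] mult.commute)
next
  case (sym s t)
  then show ?case by (simp add: norm_minus_commute abs_minus_commute)
qed

text \<open>The polygons are D-Lipschitz, so Arzela-Ascoli yields a uniform limit z. Before time 1
  the step velocities converge pointwise by continuity of v, and dominated convergence gives the
  integral equation. The radius r (1 - s) keeps z in the interior before time 1.\<close>

lemma existence:
  assumes ball: "cball x r \<subseteq> \<Omega>" and "0 < r"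
  obtains z where "\<And>s. s \<in> {0..1} \<Longrightarrow> cball (z s) (r * (1 - s)) \<subseteq> \<Omega>"
    and "\<And>t. t \<in> {0..1} \<Longrightarrow> (\<lambda>s. v s (z s)) absolutely_integrable_on {0..t}"
    and "\<And>t. t \<in> {0..1} \<Longrightarrow> z t = x + integral {0..t} (\<lambda>s. v s (z s))"
proof -
  \<comment> \<open>The index is shifted so that the number of steps is positive.\<close>
  define F where "F n = euler_path (Suc n) x" for n
  define G where "G n s = euler_velocity (Suc n) x (nat \<lfloor>real (Suc n) * s\<rfloor>)" for n s
  note lip = euler_path_lipschitz[OF ball \<open>0 < r\<close> zero_less_Suc, folded F_def]
  note G_le = euler_velocity_le[OF ball \<open>0 < r\<close> zero_less_Suc]
  have F0: "F n 0 = x" for n by (simp add: F_def euler_path_def)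
  have F_bd: "norm (F n s) \<le> norm x + D" if "s \<in> {0..1}" for n s
  proof -
    have "norm (F n s - x) \<le> D * s" using lip[of s 0 n] that by (simp add: F0)
    also have "\<dots> \<le> D" using that diam_nonneg by (simp add: mult_left_le)
    finally show ?thesis using norm_triangle_sub[of "F n s" x] by linarith
  qed
  have equi: "\<exists>d. 0 < d \<and> (\<forall>n s'. s' \<in> {0..1} \<and> norm (s - s') < d \<longrightarrow> norm (F n s - F n s') < e)"
    if s: "s \<in> {0..1}" and "0 < e" for s e
  \<comment> \<open>D + 1 instead of D makes the denominator positive.\<close>
  proof (intro exI[of _ "e / (D + 1)"] conjI allI impI)
    show "0 < e / (D + 1)" using \<open>0 < e\<close> diam_nonneg by simp
    fix n s' assume s': "s' \<in> {0..1} \<and> norm (s - s') < e / (D + 1)"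
    have "norm (F n s - F n s') \<le> D * \<bar>s - s'\<bar>" using lip s s' by simp
    also have "\<dots> \<le> (D + 1) * \<bar>s - s'\<bar>" by (intro mult_right_mono) auto
    also have "\<dots> < e"
      using s' diam_nonneg by (simp add: pos_less_divide_eq mult.commute add_nonneg_pos)
    finally show "norm (F n s - F n s') < e" .
  qed
  obtain z k where "strict_mono (k :: nat \<Rightarrow> nat)"
    and unif: "\<And>e. 0 < e \<Longrightarrow> \<exists>N. \<forall>n s. n \<ge> N \<and> s \<in> {0..1} \<longrightarrow> norm (F (k n) s - z s) < e"
    using Arzela_Ascoli[of "{0..1::real}" F "norm x + D", OF compact_Icc F_bd equi] by metis
  have Fz: "(\<lambda>n. F (k n) s) \<longlonglongrightarrow> z s" if "s \<in> {0..1}" for s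
    unfolding LIMSEQ_iff using unif that by meson
  \<comment> \<open>For each s: the index of the last node at or before s, followed by its time
    \<tau> and its position y. Before time 1 the step velocity at s is v at (\<tau>, y).\<close>
  define K where "K n s = nat \<lfloor>real (Suc (k n)) * s\<rfloor>" for n s
  define \<tau> where "\<tau> n s = real (K n s) / real (Suc (k n))" for n s
  define y where "y n s = euler (Suc (k n)) x (K n s)" for n s
  note bounds = floor_fraction_bounds[OF zero_less_Suc, where n1="k _", folded K_def, folded \<tau>_def]
  have tau01: "\<tau> n s \<in> {0..1}" if "s \<in> {0..1}" for n s
  proof -
    have "0 \<le> \<tau> n s" by (simp add: \<tau>_def)
    then show ?thesis using bounds(2)[of s n] that by auto
  qed
  \<comment> \<open>As \<tau> \<le> s, the radius at the node is at least r (1 - s), a bound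
    independent of n; \<open>v_tendsto\<close> needs such a common radius.\<close>
  have ball_y: "cball (y n s) (r * (1 - s)) \<subseteq> \<Omega>" if "s \<in> {0..1}" for n s
  proof -
    have "cball (y n s) (r * (1 - s)) \<subseteq> cball (y n s) (r * (1 - \<tau> n s))"
      using bounds(2)[of s n] that \<open>0 < r\<close> by (intro subset_cball mult_left_mono) auto
    also have "\<dots> \<subseteq> \<Omega>"
      using euler_cball[OF ball \<open>0 < r\<close> zero_less_Suc bounds(1)] that by (simp add: y_def \<tau>_def)
    finally show ?thesis .
  qed
  have Suc_k: "(\<lambda>n. 1 / real (Suc (k n))) \<longlonglongrightarrow> 0"
    using LIMSEQ_subseq_LIMSEQ[OF LIMSEQ_inverse_real_of_nat \<open>strict_mono k\<close>]
    by (simp add: o_def inverse_eq_divide)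
  have tau: "(\<lambda>n. \<tau> n s) \<longlonglongrightarrow> s" if "s \<in> {0..1}" for s
  proof -
    have "norm (\<tau> n s - s) \<le> 1 / real (Suc (k n))" for n
      using bounds(2,3)[of s n] that by auto
    then show ?thesis
      by (intro LIM_zero_cancel[of "\<lambda>n. \<tau> n s"] Lim_null_comparison[OF always_eventually Suc_k]) auto
  qed
  \<comment> \<open>The node is the polygon's value at \<tau>, so by the Lipschitz bound it is
    asymptotically the value at s.\<close>
  have yz: "(\<lambda>n. y n s) \<longlonglongrightarrow> z s" if s: "s \<in> {0..1}" for s
  proof -
    have "y n s = F (k n) (\<tau> n s)" for n
      using euler_path_node[OF ball \<open>0 < r\<close> zero_less_Suc bounds(1)] s
      by (simp add: y_def F_def \<tau>_def)
    then have le: "\<forall>n. norm (y n s - F (k n) s) \<le> D * \<bar>\<tau> n s - s\<bar>"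
      using lip tau01[OF s] s by auto
    have "(\<lambda>n. D * \<bar>\<tau> n s - s\<bar>) \<longlonglongrightarrow> D * \<bar>s - s\<bar>"
      by (intro tendsto_intros tau s)
    then have "(\<lambda>n. D * \<bar>\<tau> n s - s\<bar>) \<longlonglongrightarrow> 0" by simp
    then have "(\<lambda>n. y n s - F (k n) s) \<longlonglongrightarrow> 0"
      by (rule Lim_null_comparison[OF always_eventually[OF le]])
    from tendsto_add[OF this Fz[OF s]] show ?thesis by simp
  qed
  have ball_z: "cball (z s) (r * (1 - s)) \<subseteq> \<Omega>" if s: "s \<in> {0..1}" for s
  proof
    fix w assume w: "w \<in> cball (z s) (r * (1 - s))"
    \<comment> \<open>The same offset from the centre y n s stays in \<Omega>; closedness carries
      this over to the limit centre.\<close>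
    have "y n s + (w - z s) \<in> \<Omega>" for n
      using ball_y[OF s, of n] w by (auto simp: subset_iff dist_norm norm_minus_commute)
    moreover have "(\<lambda>n. y n s + (w - z s)) \<longlonglongrightarrow> z s + (w - z s)"
      by (intro tendsto_intros yz s)
    ultimately show "w \<in> \<Omega>"
      using closed_sequentially[OF compact_imp_closed[OF comp], of "\<lambda>n. y n s + (w - z s)"] by simp
  qed
  \<comment> \<open>The value 0 at time 1 matches the cut-off in \<open>euler_velocity\<close>, so
    convergence and the bound D hold on all of [0, 1]; the single point does not affect
    integrals.\<close>
  define f where "f s = (if s < 1 then v s (z s) else 0)" for s
  have Gf: "(\<lambda>n. G (k n) s) \<longlonglongrightarrow> f s" if s: "s \<in> {0..1}" for s
  proof (cases "s < 1")
    case True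
    have "G (k n) s = v (\<tau> n s) (y n s)" for n
    proof -
      have "real (K n s) < real (Suc (k n))"
        using le_less_trans[OF bounds(2)[of s n] True] s
        by (simp add: \<tau>_def pos_divide_less_eq)
      then have "K n s < Suc (k n)" by linarith
      then show ?thesis
        unfolding G_def K_def[symmetric] euler_velocity_def y_def \<tau>_def by simp
    qed
    moreover have "(\<lambda>n. v (\<tau> n s) (y n s)) \<longlonglongrightarrow> v s (z s)"
      using True \<open>0 < r\<close> s by (intro v_tendsto[of "r * (1 - s)"] ball_z ball_y tau01 yz tau) auto
    ultimately show ?thesis using True by (simp add: f_def)
  next
    case False
    then have "s = 1" using s by simp
    then show ?thesis by (simp add: f_def G_def euler_velocity_def del: of_nat_Suc)
  qed
  have f_int: "f integrable_on {0..t}" and f_eq: "z t = x + integral {0..t} f" if t: "t \<in> {0..1}" for t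
  proof -
    have "G (k n) integrable_on {0..t}" for n
      unfolding G_def by (rule step_function_integrable[OF G_le])
    moreover have "norm (G (k n) s) \<le> D" for n s
      unfolding G_def by (rule G_le)
    moreover have "(\<lambda>n. G (k n) s) \<longlonglongrightarrow> f s" if "s \<in> {0..t}" for s
      using that t by (intro Gf) auto
    ultimately have dom: "f integrable_on {0..t}"
      "(\<lambda>n. integral {0..t} (G (k n))) \<longlonglongrightarrow> integral {0..t} f"
      using dominated_convergence[of "\<lambda>n. G (k n)" "{0..t}" "\<lambda>_. D" f] by auto
    show "f integrable_on {0..t}" by (rule dom)
    have "(\<lambda>n. x + integral {0..t} (G (k n))) \<longlonglongrightarrow> x + integral {0..t} f"
      by (intro tendsto_intros dom)
    moreover have "F (k n) t = x + integral {0..t} (G (k n))" for n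
      unfolding F_def euler_path_def G_def ..
    ultimately have "(\<lambda>n. F (k n) t) \<longlonglongrightarrow> x + integral {0..t} f"
      by simp
    then show "z t = x + integral {0..t} f"
      using Fz[OF t] LIMSEQ_unique by blast
  qed
  show ?thesis
  proof
    fix t :: real assume t: "t \<in> {0..1}"
    show "cball (z t) (r * (1 - t)) \<subseteq> \<Omega>" by (rule ball_z[OF t])
    have "f absolutely_integrable_on {0..t}"
    proof (rule absolutely_integrable_integrable_bound)
      show "norm (f s) \<le> D" if "s \<in> {0..t}" for s
        using norm_v_le[OF ball_z, of s] that t \<open>0 < r\<close> diam_nonneg by (auto simp: f_def)
    qed (use f_int[OF t] in auto)
    then show "(\<lambda>s. v s (z s)) absolutely_integrable_on {0..t}"
      by (rule absolutely_integrable_spike[where S="{1}"]) (use t in \<open>auto simp: f_def\<close>)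
    have "integral {0..t} f = integral {0..t} (\<lambda>s. v s (z s))"
      by (rule integral_spike[where S="{1}"]) (use t in \<open>auto simp: f_def\<close>)
    then show "z t = x + integral {0..t} (\<lambda>s. v s (z s))"
      using f_eq[OF t] by simp
  qed
qed

text \<open>On [0, T] with T < 1 both trajectories trace compact subsets of the interior, so they
  have a common positive depth and Osgood's criterion applies, with K depending on that depth.
  Agreement at time 1 follows by continuity.\<close>

lemma uniqueness:
  assumes mono: "mono_on {0..D} (\<lambda>\<eta>. \<omega> \<eta> + \<eta>)"
    and div: "filterlim (\<lambda>\<epsilon>. integral {\<epsilon>..D} (\<lambda>u. 1 / (u + \<omega> u))) at_top (at_right 0)"
    and z: "\<And>s. s \<in> {0..<1} \<Longrightarrow> z s \<in> interior \<Omega>"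
      "(\<lambda>s. v s (z s)) absolutely_integrable_on {0..1}"
      "\<And>t. t \<in> {0..1} \<Longrightarrow> z t = x + integral {0..t} (\<lambda>s. v s (z s))"
    and y: "\<And>s. s \<in> {0..<1} \<Longrightarrow> y s \<in> interior \<Omega>"
      "(\<lambda>s. v s (y s)) absolutely_integrable_on {0..1}"
      "\<And>t. t \<in> {0..1} \<Longrightarrow> y t = x + integral {0..t} (\<lambda>s. v s (y s))"
    and t: "t \<in> {0..1}"
  shows "z t = y t"
proof -
  have cont: "continuous_on {0..1} f"
    if "(\<lambda>s. v s (f s)) absolutely_integrable_on {0..1}"
      "\<And>t. t \<in> {0..1} \<Longrightarrow> f t = x + integral {0..t} (\<lambda>s. v s (f s))" for f
  proof -
    have "continuous_on {0..1} (\<lambda>t. x + integral {0..t} (\<lambda>s. v s (f s)))"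
      using that(1) unfolding absolutely_integrable_on_def
      by (intro continuous_intros indefinite_integral_continuous_1) auto
    then show ?thesis by (rule continuous_on_eq) (use that(2) in auto)
  qed
  note cz = cont[OF z(2,3)] and cy = cont[OF y(2,3)]
  have before: "z T - y T = 0" if T: "T \<in> {0..<1}" for T
  proof -
    have sub: "{0..T} \<subseteq> {0..1}" using T by auto
    have "compact (z ` {0..T} \<union> y ` {0..T})"
      using continuous_on_subset[OF cz sub] continuous_on_subset[OF cy sub]
      by (intro compact_Un compact_continuous_image) auto
    moreover have "z ` {0..T} \<union> y ` {0..T} \<subseteq> interior \<Omega>"
      using z(1) y(1) T by auto
    ultimately obtain e where e: "0 < e" "(\<Union>a\<in>z ` {0..T} \<union> y ` {0..T}. ball a e) \<subseteq> interior \<Omega>"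
      using compact_subset_open_imp_ball_epsilon_subset[OF _ open_interior] by metis
    have balls: "cball (z s) (e / 2) \<subseteq> \<Omega>" "cball (y s) (e / 2) \<subseteq> \<Omega>" if "s \<in> {0..T}" for s
    proof -
      have "cball a (e / 2) \<subseteq> ball a e" for a :: 'a using e(1) by (auto simp: subset_iff)
      then show "cball (z s) (e / 2) \<subseteq> \<Omega>" "cball (y s) (e / 2) \<subseteq> \<Omega>"
        using e(2) that interior_subset[of \<Omega>] by fast+
    qed
    obtain K where "0 < K" and K: "\<And>t t' z z' \<eta>. \<lbrakk>cball z (e/2) \<subseteq> \<Omega>; cball z' (e/2) \<subseteq> \<Omega>; t \<in> {0..1};
        t' \<in> {0..1}; 0 < \<eta>; norm (z - z') + D * \<bar>t - t'\<bar> \<le> \<eta>\<rbrakk> \<Longrightarrow> norm (v t z - v t' z') \<le> K * (\<eta> + \<omega> \<eta>)"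
      using v_modulus[of "e / 2"] e(1) by (metis half_gt_zero)
    have Om: "\<Omega> \<noteq> {}" using z(1)[of 0] interior_subset by auto
    have dint: "(\<lambda>s. v s (z s) - v s (y s)) absolutely_integrable_on {0..b}" if "b \<le> 1" for b
      using that by (intro set_integral_diff(1) absolutely_integrable_on_subinterval[OF z(2)]
        absolutely_integrable_on_subinterval[OF y(2)]) auto
    have "norm (z T - y T) = 0"
    \<comment> \<open>The velocities are compared at equal times, so the time term of the modulus
      vanishes and \<eta> is the distance of the trajectories, which is at most the
      diameter.\<close>
    proof (rule osgood[where \<phi>="\<lambda>\<eta>. \<eta> + \<omega> \<eta>" and M=D and K=K and T=T
        and u="\<lambda>s. norm (z s - y s)" and w="\<lambda>s. norm (v s (z s) - v s (y s))"])
      show "mono_on {0..D} (\<lambda>\<eta>. \<eta> + \<omega> \<eta>)" using mono by (simp add: add.commute)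
      show "0 < s + \<omega> s" if "0 < s" for s
        using omega_nonneg[OF Om, of s] that by simp
      show "(\<lambda>s. norm (v s (z s) - v s (y s))) integrable_on {0..T}"
        using dint[of T] T unfolding absolutely_integrable_on_def by auto
      show "norm (z s - y s) \<le> D" if "s \<in> {0..T}" for s
        using balls[OF that] e(1) by (intro norm_diff_le_diam) auto
      show "norm (v s (z s) - v s (y s)) \<le> K * (norm (z s - y s) + \<omega> (norm (z s - y s)))"
        if "s \<in> {0..T}" for s
      \<comment> \<open>The modulus requires a positive \<eta>; at coinciding points the velocities
        are equal.\<close>
      proof (cases "z s = y s")
        case True
        then show ?thesis using omega_nonneg[OF Om, of 0] \<open>0 < K\<close> by simp
      next
        case False
        then show ?thesis using balls[OF that] that T by (intro K) auto
      qed
      show "norm (z s - y s) \<le> integral {0..s} (\<lambda>s. norm (v s (z s) - v s (y s)))"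
        if "s \<in> {0..T}" for s
      proof -
        have s: "s \<in> {0..1}" "s \<le> 1" using that T by auto
        have "z s - y s = integral {0..s} (\<lambda>s. v s (z s)) - integral {0..s} (\<lambda>s. v s (y s))"
          using z(3)[OF s(1)] y(3)[OF s(1)] by simp
        also have "\<dots> = integral {0..s} (\<lambda>s. v s (z s) - v s (y s))"
          using absolutely_integrable_on_subinterval[OF z(2), of 0 s]
            absolutely_integrable_on_subinterval[OF y(2), of 0 s] s
          unfolding absolutely_integrable_on_def
          by (intro Henstock_Kurzweil_Integration.integral_diff[symmetric]) auto
        finally show ?thesis
          using dint[OF s(2)] unfolding absolutely_integrable_on_def
          by (auto intro!: integral_norm_bound_integral)
      qed
    qed (use div \<open>0 < K\<close> T in auto)
    then show ?thesis by simp
  qed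
  have "z t - y t = 0"
  \<comment> \<open>The difference vanishes on [0, 1), whose closure contains time 1.\<close>
  proof (rule continuous_constant_on_closure[where S="{0..<1}" and f="\<lambda>t. z t - y t"])
    show "continuous_on (closure {0..<1}) (\<lambda>t. z t - y t)"
      using cz cy by (auto intro: continuous_on_diff)
    show "t \<in> closure {0..<1}" using t by simp
  qed (use before in auto)
  then show ?thesis by simp
qed

end

theorem theorem8:
  fixes \<Omega> :: "'a::euclidean_space set"
    and p0 p1 :: "'a \<Rightarrow> real"
    and x :: 'a
  assumes "compact \<Omega>" and "convex \<Omega>" and "interior \<Omega> \<noteq> {}"
    and "\<forall>z. p0 z \<ge> 0" and "\<forall>z. p1 z \<ge> 0"
    and "(p0 has_integral 1) UNIV" and "(p1 has_integral 1) UNIV"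
    and "\<forall>z. z \<notin> \<Omega> \<longrightarrow> p0 z = 0" and "\<forall>z. z \<notin> \<Omega> \<longrightarrow> p1 z = 0"
    and "continuous_on \<Omega> p0" and "continuous_on \<Omega> p1"
    and "\<exists>C. \<forall>z. p0 z \<le> C" and "\<exists>C. \<forall>z. p1 z \<le> C"
    and "\<exists>c>0. \<forall>z\<in>\<Omega>. c \<le> p0 z" and "\<exists>c>0. \<forall>z\<in>\<Omega>. c \<le> p1 z"
    and "mono_on {0..diameter \<Omega>} (\<lambda>\<eta>. rf_omega p0 p1 \<Omega> \<eta> + \<eta>)"
    and "filterlim (\<lambda>\<epsilon>. integral {\<epsilon>..diameter \<Omega>} (\<lambda>u. 1 / (u + rf_omega p0 p1 \<Omega> u)))
           at_top (at_right 0)"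
    and "x \<in> interior \<Omega>"
  shows "\<exists>z :: real \<Rightarrow> 'a.
           (\<forall>s\<in>{0..1}. z s \<in> \<Omega>) \<and> (\<forall>s\<in>{0..<1}. z s \<in> interior \<Omega>) \<and>
           (\<forall>t\<in>{0..1}. (\<lambda>s. rf_v p0 p1 \<Omega> s (z s)) absolutely_integrable_on {0..t} \<and>
                        z t = x + integral {0..t} (\<lambda>s. rf_v p0 p1 \<Omega> s (z s))) \<and>
           (\<forall>z' :: real \<Rightarrow> 'a.
              ((\<forall>s\<in>{0..1}. z' s \<in> \<Omega>) \<and> (\<forall>s\<in>{0..<1}. z' s \<in> interior \<Omega>) \<and>
               (\<forall>t\<in>{0..1}. (\<lambda>s. rf_v p0 p1 \<Omega> s (z' s)) absolutely_integrable_on {0..t} \<and>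
                        z' t = x + integral {0..t} (\<lambda>s. rf_v p0 p1 \<Omega> s (z' s))))
              \<longrightarrow> (\<forall>t\<in>{0..1}. z' t = z t))"
proof -
  obtain C0 C1 where C: "\<forall>z. p0 z \<le> C0" "\<forall>z. p1 z \<le> C1" using assms(12,13) by blast
  obtain c0 c1 where c: "0 < c0" "\<forall>z\<in>\<Omega>. c0 \<le> p0 z" "0 < c1" "\<forall>z\<in>\<Omega>. c1 \<le> p1 z"
    using assms(14,15) by blast
  \<comment> \<open>The minimum and maximum provide common bounds for both densities.\<close>
  interpret rectified_flow \<Omega> p0 p1 "min c0 c1" "max C0 C1"
    using assms(1,2,8-11) C c by unfold_locales (auto simp: min_le_iff_disj le_max_iff_disj)
  obtain r where r: "0 < r" "cball x r \<subseteq> \<Omega>"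
    using \<open>x \<in> interior \<Omega>\<close> mem_interior_cball by blast
  obtain z where z: "\<And>s. s \<in> {0..1} \<Longrightarrow> cball (z s) (r * (1 - s)) \<subseteq> \<Omega>"
    "\<And>t. t \<in> {0..1} \<Longrightarrow> (\<lambda>s. v s (z s)) absolutely_integrable_on {0..t}"
    "\<And>t. t \<in> {0..1} \<Longrightarrow> z t = x + integral {0..t} (\<lambda>s. v s (z s))"
    using existence[OF r(2,1)] by metis
  have dom: "z s \<in> \<Omega>" if "s \<in> {0..1}" for s
    using z(1)[OF that] that r(1) by auto
  have int: "z s \<in> interior \<Omega>" if "s \<in> {0..<1}" for s
    using z(1)[of s] that r(1) by (auto simp: mem_interior_cball intro!: exI[of _ "r * (1 - s)"])
  show ?thesis
  proof (intro exI[of _ z] conjI allI impI ballI)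
    fix z' t
    assume z': "(\<forall>s\<in>{0..1}. z' s \<in> \<Omega>) \<and> (\<forall>s\<in>{0..<1}. z' s \<in> interior \<Omega>) \<and>
      (\<forall>t\<in>{0..1}. (\<lambda>s. v s (z' s)) absolutely_integrable_on {0..t} \<and>
        z' t = x + integral {0..t} (\<lambda>s. v s (z' s)))" and t: "t \<in> {0..1::real}"
    show "z' t = z t"
      using z' z(2)[of 1] z(3) int t
      by (intro uniqueness[OF assms(16,17), of z' x z]) auto
  qed (use dom int z in auto)
qed

end
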